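(* For every finite field $\mathbb{F}_q$ (with $q$ elements) and every positive integer $n$ there are a set $X_n$ of cardinality $\frac{q^{n+1}-q}{q-1}+1$ and maps $f_1,\ldots,f_{n+1}\in\mathrm{Map}(X_n,\mathbb{F}_q)$ such that $\mathrm{Z}(f_1,\ldots,f_{n+1})=\emptyset$ but $\mathrm{Z}(g_1,\ldots,g_n)\neq\emptyset$ for any $g_1,\ldots,g_n\in\mathrm{Span}(f_1,\ldots,f_{n+1})$.
   Context: For a set $X$, $\mathrm{Map}(X,\mathbb{F}_q)$ denotes the $\mathbb{F}_q$-vector space of all functions $f\colon X\to\mathbb{F}_q$ (with pointwise operations). For $f_1,\ldots,f_k\in\mathrm{Map}(X,\mathbb{F}_q)$, $\mathrm{Z}(f_1,\ldots,f_k)=\{x\in X : f_1(x)=\cdots=f_k(x)=0\}$ is the set of common zeros, and $\mathrm{Span}(f_1,\ldots,f_k)$ is the $\mathbb{F}_q$-linear subspace of $\mathrm{Map}(X,\mathbb{F}_q)$ generated by $f_1,\ldots,f_k$. *)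

theory Defs
  imports Complex_Main "HOL-Library.Cardinality" "HOL-Library.Function_Algebras"
begin

(* Map(X, F): a function on X is represented by its extension by zero to the whole type.
   Restriction to X identifies this set with the space of all functions X -> F, and
   it is a linear subspace of the ambient function space (see subspace_maps below), so
   spans taken in the ambient space are spans in Map(X, F). *)
definition maps :: "'x set \<Rightarrow> ('x \<Rightarrow> 'a::zero) set"
  where "maps X = {f. \<forall>x. x \<notin> X \<longrightarrow> f x = 0}"

definition pointwise_scale :: "'a::times \<Rightarrow> ('x \<Rightarrow> 'a) \<Rightarrow> 'x \<Rightarrow> 'a"
  where "pointwise_scale c f = (\<lambda>x. c * f x)"

interpretation maps: vector_space "pointwise_scale :: 'a::field \<Rightarrow> ('x \<Rightarrow> 'a) \<Rightarrow> 'x \<Rightarrow> 'a"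
  by unfold_locales (auto simp: pointwise_scale_def algebra_simps)

lemma subspace_maps: "maps.subspace (maps X :: ('x \<Rightarrow> 'a::field) set)"
  by (auto simp: maps.subspace_def maps_def pointwise_scale_def)

definition common_zeros :: "'x set \<Rightarrow> ('x \<Rightarrow> 'a::zero) set \<Rightarrow> 'x set"
  where "common_zeros X F = {x \<in> X. \<forall>f\<in>F. f x = 0}"

end

theory Submission
  imports Defs
begin

text \<open>
  The number of points in the theorem is the number of points of the projective space
  \<open>P\<^sup>n\<close> over the field.  Take the points of \<open>P\<^sup>n\<close>, each represented by the vector whose first
  nonzero coordinate is 1, and let the maps be the coordinate functions: they have no common zero,
  whereas \<open>n\<close> linear forms in \<open>n + 1\<close> variables always have a common nontrivial zero.
\<close>

text \<open>Recursing on the leading coordinate, instead of naming the first nonzero index, makes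
  counting and normalisation plain inductions. The argument counts coordinates, so
  \<open>proj_points (Suc n)\<close> represents the points of projective n-space.\<close>

fun proj_points :: "nat \<Rightarrow> 'a::{zero,one} list set" where
  "proj_points 0 = {}"
| "proj_points (Suc m) = (#) 1 ` {v. length v = m} \<union> (#) 0 ` proj_points m"

lemma length_proj_points: "v \<in> proj_points m \<Longrightarrow> length v = m"
  by (induction m arbitrary: v) auto

lemma proj_points_nonzero:
  fixes v :: "'a::zero_neq_one list"
  shows "v \<in> proj_points m \<Longrightarrow> \<exists>i<m. v ! i \<noteq> 0"
proof (induction m arbitrary: v)
  case (Suc m)
  then consider (one) w where "v = 1 # w" | (zero) w where "v = 0 # w" "w \<in> proj_points m"
    by auto
  then show ?case
  proof cases
    case one
    then show ?thesis by (intro exI[of _ 0]) simp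
  next
    case zero
    with Suc.IH obtain i where "i < m" "w ! i \<noteq> 0" by blast
    with zero show ?thesis by (intro exI[of _ "Suc i"]) simp
  qed
qed simp

lemma one_less_CARD: "CARD('a::{zero_neq_one,finite}) > 1"
proof -
  have "card {0, 1 :: 'a} \<le> CARD('a)"
    by (rule card_mono) auto
  then show ?thesis by simp
qed

lemma card_lists_length:
  "finite {v :: 'a::finite list. length v = m}" "card {v :: 'a list. length v = m} = CARD('a) ^ m"
  using finite_lists_length_eq[of "UNIV :: 'a set" m] card_lists_length_eq[of "UNIV :: 'a set" m]
  by simp_all

lemma finite_proj_points: "finite (proj_points m :: 'a::{zero,one,finite} list set)"
  by (induction m) (simp_all add: card_lists_length)

text \<open>This is the cell decomposition of projective space: an affine cell with leading
  coordinate 1 and a hyperplane at infinity with leading coordinate 0.\<close>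

lemma card_proj_points:
  "card (proj_points m :: 'a::{zero_neq_one,finite} list set) = (\<Sum>k<m. CARD('a) ^ k)"
proof (induction m)
  case (Suc m)
  have "card (proj_points (Suc m) :: 'a list set) =
      card ((#) (1::'a) ` {v. length v = m}) + card ((#) (0::'a) ` proj_points m)"
    unfolding proj_points.simps
    by (rule card_Un_disjoint) (auto simp: card_lists_length finite_proj_points)
  with Suc show ?case
    by (simp add: card_image card_lists_length)
qed simp

text \<open>The scalar is the inverse of the first nonzero coordinate. This moves a nontrivial zero
  of homogeneous forms to a chosen representative.\<close>

lemma scale_in_proj_points:
  fixes v :: "'a::field list"
  assumes "length v = m" and "\<exists>i<m. v ! i \<noteq> 0"
  shows "\<exists>c. map ((*) c) v \<in> proj_points m"
  using assms
proof (induction m arbitrary: v)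
  case (Suc m)
  then obtain a w where v: "v = a # w" "length w = m" by (cases v) auto
  show ?case
  proof (cases "a = 0")
    case True
    with Suc.prems v have "\<exists>i<m. w ! i \<noteq> 0"
      by (auto simp: less_Suc_eq_0_disj)
    with Suc.IH v(2) obtain c where "map ((*) c) w \<in> proj_points m" by blast
    with v True show ?thesis by (intro exI[of _ c]) simp
  next
    case False
    with v show ?thesis by (intro exI[of _ "inverse a"]) auto
  qed
qed simp

text \<open>Over a finite field this is the pigeonhole principle.\<close>

lemma linear_forms_common_zero:
  fixes c :: "nat \<Rightarrow> nat \<Rightarrow> 'a::{field,finite}"
  shows "\<exists>v. length v = Suc n \<and> (\<exists>i<Suc n. v ! i \<noteq> 0) \<and>
    (\<forall>j<n. (\<Sum>i<Suc n. c j i * v ! i) = 0)"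
proof -
  \<comment> \<open>\<open>L\<close> evaluates all \<open>n\<close> forms at once, a linear map from
    \<open>Suc n\<close> to \<open>n\<close> coordinates.\<close>
  define L where "L v = map (\<lambda>j. \<Sum>i<Suc n. c j i * v ! i) [0..<n]" for v
  let ?V = "\<lambda>m. {v :: 'a list. length v = m}"
  have "card (?V n) < card (?V (Suc n))"
    using one_less_CARD[where 'a = 'a] by (simp add: card_lists_length)
  moreover have "L ` ?V (Suc n) \<subseteq> ?V n"
    by (auto simp: L_def)
  ultimately have "\<not> inj_on L (?V (Suc n))"
    using card_inj_on_le[of L "?V (Suc n)" "?V n"] card_lists_length(1)[of n, where 'a = 'a]
    by linarith
  then obtain u w where uw: "length u = Suc n" "length w = Suc n" "u \<noteq> w" "L u = L w"
    by (auto simp: inj_on_def)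
  \<comment> \<open>By linearity the difference of two colliding vectors lies in the kernel, and it
    is nonzero because they differ.\<close>
  define v where "v = map2 (-) u w"
  have v: "v ! i = u ! i - w ! i" if "i < Suc n" for i
    using that uw by (simp add: v_def)
  have "(\<Sum>i<Suc n. c j i * v ! i) = 0" if "j < n" for j
  proof -
    have "(\<Sum>i<Suc n. c j i * v ! i) = L u ! j - L w ! j"
      unfolding L_def using that
      by (simp add: v algebra_simps sum_subtractf del: sum.lessThan_Suc)
    with uw show ?thesis by simp
  qed
  moreover have "\<exists>i<Suc n. v ! i \<noteq> 0"
    using uw v by (metis nth_equalityI right_minus_eq)
  ultimately show ?thesis
    using uw by (intro exI[of _ v]) (simp add: v_def)
qed

text \<open>Coefficients are indexed by \<open>A\<close>, not by the functions in the image, so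
  coincidences among the \<open>f i\<close> do no harm. Each induction step raises the coefficient
  of a single index.\<close>

lemma span_image_coeffs:
  fixes f :: "'i \<Rightarrow> 'x \<Rightarrow> 'a::field"
  assumes "finite A" and "g \<in> maps.span (f ` A)"
  shows "\<exists>c. \<forall>x. g x = (\<Sum>i\<in>A. c i * f i x)"
  using assms(2)
proof (induction rule: maps.span_induct_alt)
  case base
  show ?case by (intro exI[of _ "\<lambda>_. 0"]) simp
next
  case (step a h k)
  then obtain j c where "j \<in> A" "h = f j" and c: "\<forall>x. k x = (\<Sum>i\<in>A. c i * f i x)"
    by blast
  moreover have "(\<Sum>i\<in>A. (if i = j then a else 0) * f i x) = a * f j x" for x
  proof -
    have "(\<Sum>i\<in>A. (if i = j then a else 0) * f i x) = (\<Sum>i\<in>A. if i = j then a * f i x else 0)"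
      by (rule sum.cong) auto
    with assms(1) \<open>j \<in> A\<close> show ?thesis by simp
  qed
  ultimately show ?case
    by (intro exI[of _ "\<lambda>i. (if i = j then a else 0) + c i"])
      (simp add: pointwise_scale_def distrib_right sum.distrib)
qed

theorem proposition2:
  fixes n :: nat
  assumes "n \<ge> 1"
  shows "\<exists>(X :: nat set) (f :: nat \<Rightarrow> nat \<Rightarrow> 'a::{field,finite}).
           finite X \<and>
           real (card X) =
             (real CARD('a) ^ (n + 1) - real CARD('a)) / (real CARD('a) - 1) + 1 \<and>
           (\<forall>i\<in>{1..n + 1}. f i \<in> maps X) \<and>
           common_zeros X (f ` {1..n + 1}) = {} \<and>
           (\<forall>g :: nat \<Rightarrow> nat \<Rightarrow> 'a.
              (\<forall>j\<in>{1..n}. g j \<in> maps.span (f ` {1..n + 1})) \<longrightarrow>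
              common_zeros X (g ` {1..n}) \<noteq> {})"
proof -
  let ?P = "proj_points (Suc n) :: 'a list set"
  \<comment> \<open>The theorem asks for a set of naturals, so the projective points are numbered by
    \<open>e\<close>.\<close>
  obtain e where e: "bij_betw e {0..<card ?P} ?P"
    using ex_bij_betw_nat_finite[OF finite_proj_points] by blast
  define X where "X = {0..<card ?P}"
  \<comment> \<open>Coordinate functions: the shift \<open>i - 1\<close> matches indices from 1 with
    list positions from 0, and the value 0 off \<open>X\<close> gives membership in
    \<open>maps X\<close>.\<close>
  define f where "f i x = (if x \<in> X then e x ! (i - 1) else 0)" for i x
  have eX: "e ` X = ?P"
    using e by (simp add: X_def bij_betw_def)
  have q: "real CARD('a) \<noteq> 1"
    using one_less_CARD[where 'a = 'a] by linarith
  have "real (card X) = (\<Sum>k<Suc n. real CARD('a) ^ k)"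
    by (simp only: X_def card_proj_points card_atLeastLessThan diff_zero of_nat_sum of_nat_power)
  also have "\<dots> = (real CARD('a) ^ Suc n - 1) / (real CARD('a) - 1)"
    using q by (rule geometric_sum)
  \<comment> \<open>The summand 1 is (q - 1)/(q - 1), which turns -q into -1 in the
    numerator.\<close>
  also have "\<dots> = (real CARD('a) ^ (n + 1) - real CARD('a)) / (real CARD('a) - 1) + 1"
    using q by (simp add: field_simps)
  finally have "real (card X) =
      (real CARD('a) ^ (n + 1) - real CARD('a)) / (real CARD('a) - 1) + 1" .
  moreover have "common_zeros X (f ` {1..n + 1}) = {}"
  proof -
    have "\<exists>i\<in>{1..n + 1}. f i x \<noteq> 0" if "x \<in> X" for x
    proof -
      have "e x \<in> ?P"
        unfolding eX [symmetric] using that by (rule imageI)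
      from proj_points_nonzero[OF this] obtain i where "i < Suc n" "e x ! i \<noteq> 0"
        by blast
      with that show ?thesis
        by (intro bexI[of _ "Suc i"]) (auto simp: f_def)
    qed
    then show ?thesis by (auto simp: common_zeros_def)
  qed
  moreover have "common_zeros X (g ` {1..n}) \<noteq> {}"
    if g: "\<forall>j\<in>{1..n}. g j \<in> maps.span (f ` {1..n + 1})" for g :: "nat \<Rightarrow> nat \<Rightarrow> 'a"
  proof -
    have "\<forall>j\<in>{1..n}. \<exists>c. \<forall>x. g j x = (\<Sum>i\<in>{1..n + 1}. c i * f i x)"
      using g span_image_coeffs by blast
    then obtain c where c: "g j x = (\<Sum>i\<in>{1..n + 1}. c j i * f i x)" if "j \<in> {1..n}" for j x
      by metis
    \<comment> \<open>On \<open>X\<close> each \<open>g j\<close> is a linear form in the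
      coordinates of the point; its coefficients are shifted to start at 0.\<close>
    obtain v where v: "length v = Suc n" "\<exists>i<Suc n. v ! i \<noteq> 0"
        "\<forall>j<n. (\<Sum>i<Suc n. c (Suc j) (Suc i) * v ! i) = 0"
      using linear_forms_common_zero[of n "\<lambda>j i. c (Suc j) (Suc i)"] by blast
    obtain a where "map ((*) a) v \<in> ?P"
      using scale_in_proj_points[OF v(1,2)] by blast
    then obtain x where x: "x \<in> X" "e x = map ((*) a) v"
      using eX by (metis imageE)
    have "g j x = 0" if j: "j \<in> {1..n}" for j
    proof -
      have "g j x = (\<Sum>i<Suc n. c j (Suc i) * f (Suc i) x)"
        by (simp only: c[OF j] One_nat_def add_Suc_right add_0_right sum.atLeast1_atMost_eq)
      \<comment> \<open>Homogeneity: rescaling \<open>v\<close> to the representative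
        \<open>e x\<close> only multiplies the form by \<open>a\<close>.\<close>
      also have "\<dots> = a * (\<Sum>i<Suc n. c j (Suc i) * v ! i)"
        unfolding sum_distrib_left using x v(1) by (intro sum.cong) (simp_all add: f_def)
      also have "\<dots> = 0"
        using v(3) j by (cases j) (simp_all del: sum.lessThan_Suc)
      finally show ?thesis .
    qed
    with x show ?thesis by (auto simp: common_zeros_def)
  qed
  ultimately show ?thesis
    by (intro exI[of _ X] exI[of _ f]) (auto simp: X_def f_def maps_def)
qed

end
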